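(* Let $n\ge 3$ be an integer and let $0<x_1\le x_2\le\dots\le x_n$ be positive integers with $\sigma_{n-2}(x_1,\dots,x_n)=\sigma_n(x_1,\dots,x_n)$. Then (1) $\displaystyle \binom{n}{2}^{\frac n2}\le x_1x_2\cdots x_n\le 2^{n-1}\,n!\,v_1v_2\cdots v_n$; (2) $\displaystyle x_1x_2\cdots x_{n-2}\le 2^{n-2}\,(n-1)!\,v_1v_2\cdots v_{n-2}$.
   Context: For $1\le j\le n$, $\sigma_j(x_1,\dots,x_n)=\sum_{1\le i_1<\dots<i_j\le n}x_{i_1}\cdots x_{i_j}$ is the $j$th elementary symmetric polynomial. The sequence $(v_n)_{n\ge1}$ is defined recursively by $v_1=1$, $v_2=2$, and for $n\ge 2$ $$v_{n+1}=1+\frac{\sum_{1\le i\le n}\frac{1}{v_i}}{1-\sum_{1\le i<j\le n}\frac{1}{v_iv_j}}.$$ Its first terms are $1,2,4,15,219,47863,\dots$; it is an increasing sequence of positive integers. *)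

theory Defs
  imports Complex_Main
begin

(* The variables are x 1, ..., x n (indices start at 1). An increasing index tuple
   i_1 < ... < i_j in {1..n} is encoded as the j-element subset {i_1, ..., i_j}. *)
definition elem_sym :: "nat \<Rightarrow> nat \<Rightarrow> (nat \<Rightarrow> 'a::comm_semiring_1) \<Rightarrow> 'a" where
  "elem_sym j n x = (\<Sum>I | I \<subseteq> {1..n} \<and> card I = j. \<Prod>i\<in>I. x i)"

(* The sequence is indexed from 1; the value at 0 is a dummy and is used nowhere.
   All terms are in fact integers, but the recursion divides, hence type real.
   The recursion is restated with its natural indexing in vseq_rec. *)
fun vseq :: "nat \<Rightarrow> real" where
  "vseq 0 = 0"
| "vseq (Suc 0) = 1"
| "vseq (Suc (Suc 0)) = 2"
| "vseq (Suc (Suc (Suc n))) =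
     1 + (\<Sum>i\<in>{1..n+2}. 1 / vseq i)
           / (1 - (\<Sum>j\<in>{1..n+2}. \<Sum>i\<in>{1..<j}. 1 / (vseq i * vseq j)))"

lemma vseq_rec:
  assumes "n \<ge> 2"
  shows "vseq (n + 1) =
     1 + (\<Sum>i\<in>{1..n}. 1 / vseq i)
           / (1 - (\<Sum>(i, j)\<in>{(i, j). 1 \<le> i \<and> i < j \<and> j \<le> n}. 1 / (vseq i * vseq j)))"
proof -
  obtain m where m: "n = m + 2"
    using assms by (metis add.commute le_Suc_ex)
  have "(\<Sum>j\<in>{1..n}. \<Sum>i\<in>{1..<j}. 1 / (vseq i * vseq j))
      = (\<Sum>(j, i)\<in>Sigma {1..n} (\<lambda>j. {1..<j}). 1 / (vseq i * vseq j))"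
    by (rule sum.Sigma) auto
  also have "\<dots> = (\<Sum>(i, j)\<in>{(i, j). 1 \<le> i \<and> i < j \<and> j \<le> n}. 1 / (vseq i * vseq j))"
    by (rule sum.reindex_bij_witness[of _ prod.swap prod.swap]) auto
  finally show ?thesis
    using m by simp
qed

lemma vseq_first_terms:
  "vseq 1 = 1" "vseq 2 = 2" "vseq 3 = 4" "vseq 4 = 15" "vseq 5 = 219" "vseq 6 = 47863"
  by (simp_all add: numeral_eq_Suc atLeastAtMostSuc_conv atLeastLessThanSuc)

end

theory Submission
  imports Defs
begin

text \<open>
Dividing by the product turns the hypothesis into \<open>e\<^sub>2(1/x\<^sub>1, \<dots>, 1/x\<^sub>n) = 1\<close>, and the lower bound
is AM-GM for the summands.

For the upper bounds the point is that among sorted positive integers with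
\<open>e\<^sub>2(1/x\<^sub>1, \<dots>, 1/x\<^sub>k) < 1\<close> the sequence \<open>v\<close> maximizes both \<open>e\<^sub>1\<close> and \<open>e\<^sub>2\<close> of the
reciprocals. This is shown by induction on \<open>k\<close>, as in Soundararajan's treatment of Sylvester's
sequence. If some tail product of \<open>x\<close> is at least that of \<open>v\<close>, take the shortest such tail: its
reciprocals are log-majorized by those of \<open>v\<close>, so \<open>e\<^sub>1\<close> and \<open>e\<^sub>2\<close> of the tail are dominated, and the
remaining prefix is covered by induction. Otherwise the full product of \<open>x\<close> is less than that of
\<open>v\<close>, and by integrality \<open>1 - e\<^sub>2(1/x) \<ge> 1/\<Prod>x > 1/\<Prod>v = 1 - e\<^sub>2(1/v)\<close>; this bound on \<open>e\<^sub>2\<close>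
also forces the one on \<open>e\<^sub>1\<close>.

Hence \<open>e\<^sub>1/(1 - e\<^sub>2) \<le> v\<^bsub>k+1\<^esub> - 1\<close> for the first \<open>k\<close> terms, and estimating the pairs that
involve an index above \<open>k\<close> gives \<open>x\<^bsub>k+1\<^esub> \<le> (n - k)(n + k - 1)/(2k) v\<^bsub>k+1\<^esub>\<close>. The product of
these factors is a factorial times a binomial coefficient over a power of two.
\<close>

section \<open>Second elementary symmetric sums over finite index sets\<close>

text \<open>The second elementary symmetric polynomial, written by Newton's identity: splitting the
  index set then becomes plain algebra with sums and sums of squares.\<close>

definition pair_sum :: "('a \<Rightarrow> real) \<Rightarrow> 'a set \<Rightarrow> real" where
  "pair_sum y I = ((sum y I)\<^sup>2 - (\<Sum>i\<in>I. (y i)\<^sup>2)) / 2"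

lemma pair_sum_Un:
  assumes "finite I" "finite J" "I \<inter> J = {}"
  shows "pair_sum y (I \<union> J) = pair_sum y I + sum y I * sum y J + pair_sum y J"
  using assms by (simp add: pair_sum_def sum.union_disjoint power2_eq_square field_simps)

lemma pair_sum_insert:
  assumes "finite I" "a \<notin> I"
  shows "pair_sum y (insert a I) = pair_sum y I + sum y I * y a"
  using assms by (simp add: pair_sum_def power2_eq_square field_simps)

lemma pair_sum_empty [simp]: "pair_sum y {} = 0"
  by (simp add: pair_sum_def)

lemma pair_sum_cong: "(\<And>i. i \<in> I \<Longrightarrow> y i = z i) \<Longrightarrow> pair_sum y I = pair_sum z I"
  by (simp add: pair_sum_def)

lemma pair_sum_double:
  assumes "finite I"
  shows "2 * pair_sum y I = (\<Sum>i\<in>I. \<Sum>j\<in>I - {i}. y i * y j)"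
proof -
  have "(\<Sum>i\<in>I. \<Sum>j\<in>I - {i}. y i * y j) = (\<Sum>i\<in>I. (\<Sum>j\<in>I. y i * y j) - (y i)\<^sup>2)"
    using assms by (intro sum.cong) (auto simp: sum_diff1 power2_eq_square)
  also have "\<dots> = (sum y I)\<^sup>2 - (\<Sum>i\<in>I. (y i)\<^sup>2)"
    by (simp add: sum_subtractf power2_eq_square sum_product)
  finally show ?thesis
    by (simp add: pair_sum_def)
qed

lemma pair_sum_nonneg:
  assumes "finite I" "\<And>i. i \<in> I \<Longrightarrow> 0 \<le> y i"
  shows "0 \<le> pair_sum y I"
proof -
  have "0 \<le> 2 * pair_sum y I"
    unfolding pair_sum_double[OF assms(1)] using assms(2) by (intro sum_nonneg) auto
  then show ?thesis by simp
qed

lemma pair_sum_mono_set: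
  assumes "finite I" "J \<subseteq> I" "\<And>i. i \<in> I \<Longrightarrow> 0 \<le> y i"
  shows "pair_sum y J \<le> pair_sum y I"
proof -
  have fin: "finite J" "finite (I - J)"
    using assms finite_subset by auto
  have "pair_sum y I = pair_sum y J + sum y J * sum y (I - J) + pair_sum y (I - J)"
    using pair_sum_Un[OF fin] assms(2) by (simp add: Un_absorb1)
  moreover have "0 \<le> sum y J" "0 \<le> sum y (I - J)"
    using assms by (auto intro!: sum_nonneg)
  moreover have "0 \<le> pair_sum y (I - J)"
    using fin assms(3) by (intro pair_sum_nonneg) auto
  ultimately show ?thesis by simp
qed

lemma pair_sum_Suc:
  "pair_sum y {1..Suc k} = pair_sum y {1..k} + sum y {1..k} * y (Suc k)"
  using pair_sum_insert[of "{1..k}" "Suc k" y] by (simp add: atLeastAtMostSuc_conv)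

lemma pair_sum_ordered:
  "pair_sum y {1..n} = (\<Sum>j\<in>{1..n}. \<Sum>i\<in>{1..<j}. y i * y j)" for n :: nat
proof (induction n)
  case (Suc n)
  have "pair_sum y {1..Suc n} = pair_sum y {1..n} + (\<Sum>i\<in>{1..<Suc n}. y i * y (Suc n))"
    by (simp only: pair_sum_Suc sum_distrib_right atLeastLessThanSuc_atLeastAtMost)
  then show ?case using Suc by simp
qed simp

text \<open>Links \<open>pair_sum\<close> to the subset encoding of \<open>elem_sym\<close>. A
  two-element subset of \<open>insert a A\<close> either avoids \<open>a\<close> or is
  \<open>{a, b}\<close> with \<open>b\<close> in \<open>A\<close>.\<close>

lemma pair_sum_subsets:
  assumes "finite A"
  shows "(\<Sum>J | J \<subseteq> A \<and> card J = 2. \<Prod>i\<in>J. y i) = pair_sum y A"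
  using assms
proof (induction A)
  case empty
  have "{J. J \<subseteq> {} \<and> card J = 2} = {}" by auto
  then show ?case by simp
next
  case (insert a A)
  have split: "{J. J \<subseteq> insert a A \<and> card J = 2} = {J. J \<subseteq> A \<and> card J = 2} \<union> (\<lambda>b. {a, b}) ` A"
    using insert.hyps by (auto simp: card_2_iff)
  have inj: "inj_on (\<lambda>b. {a, b}) A"
    by (auto simp: inj_on_def doubleton_eq_iff)
  have "(\<Sum>J | J \<subseteq> insert a A \<and> card J = 2. \<Prod>i\<in>J. y i)
      = (\<Sum>J | J \<subseteq> A \<and> card J = 2. \<Prod>i\<in>J. y i) + (\<Sum>J\<in>(\<lambda>b. {a, b}) ` A. \<Prod>i\<in>J. y i)"
    unfolding split using insert.hyps by (intro sum.union_disjoint) auto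
  also have "(\<Sum>J\<in>(\<lambda>b. {a, b}) ` A. \<Prod>i\<in>J. y i) = (\<Sum>b\<in>A. \<Prod>i\<in>{a, b}. y i)"
    using inj by (simp add: sum.reindex)
  also have "\<dots> = (\<Sum>b\<in>A. y b * y a)"
    using insert.hyps by (intro sum.cong refl) (subst prod.insert, auto simp: mult.commute)
  finally show ?case
    using insert by (simp add: pair_sum_insert sum_distrib_right)
qed

section \<open>Clearing denominators; the hypothesis in terms of reciprocals\<close>

lemma prod_div_Ints:
  fixes z :: "nat \<Rightarrow> real"
  assumes "finite I" "J \<subseteq> I" "\<And>i. i \<in> I \<Longrightarrow> z i \<in> \<int>" "\<And>i. i \<in> I \<Longrightarrow> z i \<noteq> 0"
  shows "prod z I * (\<Prod>i\<in>J. 1 / z i) \<in> \<int>"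
proof -
  have "prod z I * (\<Prod>i\<in>J. 1 / z i) = prod z (I - J)"
    using assms finite_subset[OF assms(2,1)]
    by (subst prod.subset_diff[OF assms(2,1)]) (auto simp: prod_dividef subset_iff)
  then show ?thesis using assms(3) by (auto intro: Ints_prod)
qed

lemma prod_mult_pair_sum_Ints:
  fixes z :: "nat \<Rightarrow> real"
  assumes "finite I" "\<And>i. i \<in> I \<Longrightarrow> z i \<in> \<int>" "\<And>i. i \<in> I \<Longrightarrow> z i \<noteq> 0"
  shows "prod z I * pair_sum (\<lambda>i. 1 / z i) I \<in> \<int>"
  unfolding pair_sum_subsets[OF assms(1), symmetric] sum_distrib_left
  using prod_div_Ints[OF assms(1) _ assms(2,3)] by (intro Ints_sum) auto

lemma elem_sym_top: "elem_sym n n x = (\<Prod>i\<in>{1..n}. x i)"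
proof -
  have "{I. I \<subseteq> {1..n} \<and> card I = n} = {{1..n}}"
    by (auto dest: card_subset_eq[OF finite_atLeastAtMost])
  then show ?thesis by (simp add: elem_sym_def)
qed

text \<open>Complementation matches the subsets of size \<open>n - 2\<close> with those of size 2,
  and the product over a subset is the full product times the reciprocals over its
  complement.\<close>

lemma elem_sym_minus_2:
  fixes z :: "nat \<Rightarrow> real"
  assumes "n \<ge> 2" "\<And>i. i \<in> {1..n} \<Longrightarrow> z i \<noteq> 0"
  shows "elem_sym (n - 2) n z = (\<Prod>i\<in>{1..n}. z i) * pair_sum (\<lambda>i. 1 / z i) {1..n}"
proof -
  have "elem_sym (n - 2) n z
      = (\<Sum>J | J \<subseteq> {1..n} \<and> card J = 2. (\<Prod>i\<in>{1..n}. z i) * (\<Prod>i\<in>J. 1 / z i))"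
    unfolding elem_sym_def
  proof (rule sum.reindex_bij_witness[of _ "\<lambda>J. {1..n} - J" "\<lambda>J. {1..n} - J"], goal_cases)
    case (5 I)
    then have "({1..n} - ({1..n} - I)) = I" by auto
    then show ?case
      using assms(2) prod.subset_diff[of "{1..n} - I" "{1..n}" z]
      by (auto simp: prod_dividef)
  qed (use assms(1) in \<open>auto simp: card_Diff_subset finite_subset[of _ "{Suc 0..n}"]\<close>)
  then show ?thesis
    by (simp add: sum_distrib_left pair_sum_subsets[symmetric])
qed

section \<open>The sequence v: uniform recursion, product identity, integrality\<close>

text \<open>Extends the recursion to \<open>k = 0\<close> and \<open>k = 1\<close>, where the pair
  sum vanishes and the formula returns the initial values 1 and 2.\<close>

lemma vseq_Suc:
  "vseq (Suc k) = 1 + (\<Sum>i\<in>{1..k}. 1 / vseq i) / (1 - pair_sum (\<lambda>i. 1 / vseq i) {1..k})"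
proof -
  consider "k = 0" | "k = 1" | m where "k = m + 2"
    by (metis One_nat_def add_2_eq_Suc' nat.exhaust)
  then show ?thesis
  proof cases
    case 3
    then show ?thesis
      using vseq.simps(4)[of m]
      by (simp only: pair_sum_ordered add_2_eq_Suc' times_divide_times_eq mult_1_left)
  qed (simp_all add: pair_sum_def)
qed

declare vseq.simps(2-) [simp del]

text \<open>Write P, S and D for the product, the reciprocal sum and the defect 1 minus the pair sum
  of the first k terms. From P D = 1 the recursion gives v = 1 + P S for the next term, and the new
  product times the new defect is P v (D - S / v) = v - P S = 1. Positivity is carried along to
  permit the divisions.\<close>

lemma vseq_prefix:
  shows "(\<forall>i\<in>{1..k}. 1 \<le> vseq i)
    \<and> (\<Prod>i\<in>{1..k}. vseq i) * (1 - pair_sum (\<lambda>i. 1 / vseq i) {1..k}) = 1"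
proof (induction k)
  case (Suc k)
  let ?w = "\<lambda>i. 1 / vseq i" and ?P = "\<Prod>i\<in>{1..k}. vseq i"
  have pos: "\<forall>i\<in>{1..k}. 1 \<le> vseq i" and D: "?P * (1 - pair_sum ?w {1..k}) = 1"
    using Suc by auto
  have P: "?P > 0"
    using pos by (intro prod_pos) force
  have v: "vseq (Suc k) = 1 + ?P * sum ?w {1..k}"
  proof -
    have "1 - pair_sum ?w {1..k} = 1 / ?P"
      using D P by (subst nonzero_eq_divide_eq) (auto simp only: mult.commute)
    then show ?thesis by (simp only: vseq_Suc) simp
  qed
  have "0 \<le> sum ?w {1..k}"
    using pos by (intro sum_nonneg) force
  then have v1: "1 \<le> vseq (Suc k)"
    using v P by simp
  have "?P * vseq (Suc k) * (1 - pair_sum ?w {1..k} - sum ?w {1..k} / vseq (Suc k))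
      = vseq (Suc k) * (?P * (1 - pair_sum ?w {1..k})) - ?P * sum ?w {1..k}"
    using v1 by (simp add: field_simps)
  also have "\<dots> = 1"
    using D v by simp
  finally show ?case
    using pos v1 by (auto simp: pair_sum_Suc[unfolded One_nat_def] le_Suc_eq diff_diff_eq)
qed simp

lemma vseq_ge_1: "1 \<le> i \<Longrightarrow> 1 \<le> vseq i"
  using vseq_prefix[of i] by auto

lemma prod_vseq_ge_1: "1 \<le> (\<Prod>i\<in>{1..k}. vseq i)"
  by (intro prod_ge_1) (auto intro: vseq_ge_1)

lemma prod_vseq_pair_sum:
  "1 - pair_sum (\<lambda>i. 1 / vseq i) {1..k} = 1 / (\<Prod>i\<in>{1..k}. vseq i)"
proof -
  have "(\<Prod>i\<in>{1..k}. vseq i) \<noteq> 0"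
    using prod_vseq_ge_1[of k] by linarith
  then show ?thesis
    using vseq_prefix[of k] by (simp only: eq_divide_eq mult.commute) simp
qed

lemma vseq_Suc_prod: "vseq (Suc k) = 1 + (\<Prod>i\<in>{1..k}. vseq i) * (\<Sum>i\<in>{1..k}. 1 / vseq i)"
  using vseq_Suc[of k] by (simp only: prod_vseq_pair_sum) simp

lemma vseq_Ints: "vseq k \<in> \<int>"
proof (induction k rule: less_induct)
  case (less k)
  show ?case
  proof (cases k)
    case (Suc m)
    have nz: "vseq i \<noteq> 0" if "i \<in> {1..m}" for i
      using vseq_ge_1[of i] that by auto
    have "(\<Prod>i\<in>{1..m}. vseq i) * (\<Prod>j\<in>{i}. 1 / vseq j) \<in> \<int>" if "i \<in> {1..m}" for i
      using that less.IH Suc nz by (intro prod_div_Ints) auto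
    then show ?thesis
      unfolding Suc vseq_Suc_prod sum_distrib_left by (intro Ints_add Ints_1 Ints_sum) auto
  qed simp
qed

text \<open>From the fourth term on, the first three terms alone contribute product 8 and reciprocal
  sum 7/4 to \<open>vseq_Suc_prod\<close>. The bound serves the case \<open>j >= 3\<close> of
  \<open>vseq_sum_max\<close>.\<close>

lemma vseq_ge_4:
  assumes "3 \<le> k"
  shows "4 \<le> vseq k"
proof (cases "k = 3")
  case False
  then obtain m where k: "k = Suc m" and m: "3 \<le> m"
    using assms by (cases k) auto
  have "(\<Sum>i\<in>{1..3}. 1 / vseq i) \<le> (\<Sum>i\<in>{1..m}. 1 / vseq i)"
    using m vseq_ge_1 by (intro sum_mono2) (force intro: order_trans[OF zero_le_one])+
  then have s: "1 \<le> (\<Sum>i\<in>{1..m}. 1 / vseq i)"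
    using vseq_first_terms by (simp add: numeral_eq_Suc)
  have "(\<Prod>i\<in>{1..3}. vseq i) \<le> (\<Prod>i\<in>{1..m}. vseq i)"
    using m by (intro prod_mono2) (force intro: vseq_ge_1 order_trans[OF zero_le_one])+
  then have p: "8 \<le> (\<Prod>i\<in>{1..m}. vseq i)"
    using vseq_first_terms by (simp add: numeral_eq_Suc)
  have "8 * 1 \<le> (\<Prod>i\<in>{1..m}. vseq i) * (\<Sum>i\<in>{1..m}. 1 / vseq i)"
    using s p by (intro mult_mono) auto
  then show ?thesis
    unfolding k vseq_Suc_prod by simp
qed (simp add: vseq_first_terms)

section \<open>Summation by parts and log-majorization\<close>

lemma abel_sum_nonneg:
  fixes c l :: "nat \<Rightarrow> real"
  assumes "i \<le> k"
    and "\<And>t. t \<in> {i..k} \<Longrightarrow> 0 \<le> c t"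
    and "\<And>t. \<lbrakk>i \<le> t; t < k\<rbrakk> \<Longrightarrow> c (Suc t) \<le> c t"
    and "\<And>t. t \<in> {i..k} \<Longrightarrow> 0 \<le> sum l {i..t}"
  shows "0 \<le> (\<Sum>t\<in>{i..k}. c t * l t)"
proof -
  \<comment> \<open>The boundary term of the summation by parts has to be kept for the induction to
    go through.\<close>
  have "c k * sum l {i..k} \<le> (\<Sum>t\<in>{i..k}. c t * l t)"
    using assms
  proof (induction k rule: dec_induct)
    case (step k)
    have "c k * sum l {i..k} \<le> (\<Sum>t\<in>{i..k}. c t * l t)"
      using step.prems by (intro step.IH) auto
    moreover have "c (Suc k) * sum l {i..k} \<le> c k * sum l {i..k}"
      using step.hyps step.prems by (intro mult_right_mono) auto
    ultimately show ?case
      using step.hyps by (simp add: algebra_simps)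
  qed simp
  moreover have "0 \<le> c k * sum l {i..k}"
    using assms by simp
  ultimately show ?thesis by linarith
qed

text \<open>By \<open>dom\<close> the log-ratios \<open>l\<close> have nonnegative partial sums. A
  tangent estimate bounds the gain from \<open>a\<close> to \<open>b\<close> below by a sum of
  \<open>l t\<close> with weight \<open>a t\<close> for sums, and \<open>a t\<close> times the sum
  of the other entries for pair sums. Both weights decrease, so \<open>abel_sum_nonneg\<close>
  applies.\<close>

lemma log_majorization:
  fixes a b :: "nat \<Rightarrow> real"
  assumes "i \<le> k"
    and a: "\<And>t. t \<in> {i..k} \<Longrightarrow> 0 < a t"
    and b: "\<And>t. t \<in> {i..k} \<Longrightarrow> 0 < b t"
    and dec: "\<And>s t. \<lbrakk>i \<le> s; s \<le> t; t \<le> k\<rbrakk> \<Longrightarrow> a t \<le> a s"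
    and dom: "\<And>t. t \<in> {i..k} \<Longrightarrow> prod a {i..t} \<le> prod b {i..t}"
  shows "sum a {i..k} \<le> sum b {i..k}" "pair_sum a {i..k} \<le> pair_sum b {i..k}"
proof -
  have nz: "a t \<noteq> 0" "b t \<noteq> 0" if "t \<in> {i..k}" for t
    using a[OF that] b[OF that] by auto
  define l where "l t = ln (b t) - ln (a t)" for t
  have l_sum: "0 \<le> sum l {i..t}" if "t \<in> {i..k}" for t
  proof -
    have "ln (prod a {i..t}) \<le> ln (prod b {i..t})"
      using that a b dom[OF that] by (subst ln_le_cancel_iff) (auto intro!: prod_pos)
    moreover have "ln (prod a {i..t}) = (\<Sum>s\<in>{i..t}. ln (a s))"
      using that nz by (intro ln_prod) auto
    moreover have "ln (prod b {i..t}) = (\<Sum>s\<in>{i..t}. ln (b s))"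
      using that nz by (intro ln_prod) auto
    ultimately show ?thesis
      by (simp add: l_def sum_subtractf)
  qed
  \<comment> \<open>Convexity of exp: its graph lies above the tangent at ln p, evaluated at ln
    q.\<close>
  have tangent: "p * (1 + (ln q - ln p)) \<le> q" if "0 < p" "0 < q" for p q :: real
  proof -
    have "ln (q / p) \<le> q / p - 1"
      using that by (intro ln_le_minus_one) simp
    then have "p * ln (q / p) \<le> p * (q / p - 1)"
      using that by (intro mult_left_mono) auto
    then show ?thesis
      using that by (simp add: ln_div algebra_simps)
  qed
  have "0 \<le> (\<Sum>t\<in>{i..k}. a t * l t)"
    using assms(1) a dec l_sum by (intro abel_sum_nonneg) (auto intro: less_imp_le)
  moreover have "(\<Sum>t\<in>{i..k}. a t * (1 + l t)) \<le> sum b {i..k}"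
    unfolding l_def by (intro sum_mono tangent a b)
  ultimately show "sum a {i..k} \<le> sum b {i..k}"
    by (simp add: distrib_left sum.distrib)
  let ?I = "{i..k}" and ?s = "sum a {i..k}"
  have rest: "?s - a t = sum a (?I - {t})" if "t \<in> ?I" for t
    using that by (simp add: sum_diff1)
  have "0 \<le> (\<Sum>t\<in>?I. a t * (?s - a t) * l t)"
  proof (intro abel_sum_nonneg assms(1) l_sum)
    show "0 \<le> a t * (?s - a t)" if "t \<in> ?I" for t
      using that a unfolding rest[OF that]
      by (intro mult_nonneg_nonneg sum_nonneg) (auto intro: less_imp_le)
    \<comment> \<open>The difference of the two sides factors as
      \<open>(a t - a (Suc t)) * (?s - a t - a (Suc t))\<close>.\<close>
    show "a (Suc t) * (?s - a (Suc t)) \<le> a t * (?s - a t)" if t: "i \<le> t" "t < k" for t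
    proof -
      have "sum a {t, Suc t} \<le> ?s"
        using t a by (intro sum_mono2) (auto intro: less_imp_le)
      then have "0 \<le> (a t - a (Suc t)) * (?s - a t - a (Suc t))"
        using t dec[of t "Suc t"] by (intro mult_nonneg_nonneg) auto
      then show ?thesis by (simp add: algebra_simps)
    qed
  qed
  moreover have "2 * pair_sum a ?I + 2 * (\<Sum>t\<in>?I. a t * (?s - a t) * l t) \<le> 2 * pair_sum b ?I"
  proof -
    have cross: "(\<Sum>t\<in>?I. \<Sum>s\<in>?I - {t}. a t * a s * l t) = (\<Sum>t\<in>?I. a t * (?s - a t) * l t)"
      by (intro sum.cong refl)
        (simp add: rest sum_distrib_left sum_distrib_right mult_ac)
    \<comment> \<open>Filling the diagonal with zeros makes the index range rectangular, so that the
      two summations can be exchanged.\<close>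
    have pairs: "(\<Sum>t\<in>?I. \<Sum>s\<in>?I - {t}. f t s) = (\<Sum>t\<in>?I. \<Sum>s\<in>?I. if s = t then 0 else f t s)"
      for f :: "nat \<Rightarrow> nat \<Rightarrow> real"
      by (intro sum.cong refl sum.mono_neutral_cong_left) auto
    have swap: "(\<Sum>t\<in>?I. \<Sum>s\<in>?I - {t}. a t * a s * l s) = (\<Sum>t\<in>?I. \<Sum>s\<in>?I - {t}. a t * a s * l t)"
      unfolding pairs by (subst sum.swap) (auto intro!: sum.cong)
    have "2 * pair_sum a ?I + 2 * (\<Sum>t\<in>?I. a t * (?s - a t) * l t)
        = (\<Sum>t\<in>?I. \<Sum>s\<in>?I - {t}. a t * a s) + (\<Sum>t\<in>?I. \<Sum>s\<in>?I - {t}. a t * a s * l t)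
          + (\<Sum>t\<in>?I. \<Sum>s\<in>?I - {t}. a t * a s * l s)"
      unfolding swap cross by (simp add: pair_sum_double)
    also have "\<dots> = (\<Sum>t\<in>?I. \<Sum>s\<in>?I - {t}. a t * a s * (1 + (l t + l s)))"
      by (simp add: sum.distrib distrib_left)
    also have "\<dots> \<le> (\<Sum>t\<in>?I. \<Sum>s\<in>?I - {t}. b t * b s)"
    proof (intro sum_mono)
      fix t s assume "t \<in> ?I" "s \<in> ?I - {t}"
      then have "0 < a t" "0 < a s" "0 < b t" "0 < b s"
        using a b by auto
      then show "a t * a s * (1 + (l t + l s)) \<le> b t * b s"
        using tangent[of "a t * a s" "b t * b s"] by (simp add: l_def ln_mult algebra_simps)
    qed
    finally show ?thesis by (simp add: pair_sum_double)
  qed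
  ultimately show "pair_sum a ?I \<le> pair_sum b ?I" by linarith
qed

section \<open>Extremality of v among sorted sequences of positive integers\<close>

lemma sum_squares_le:
  fixes y :: "nat \<Rightarrow> real"
  assumes "finite I" "\<And>i. i \<in> I \<Longrightarrow> 0 \<le> y i" "\<And>i. i \<in> I \<Longrightarrow> y i \<le> m"
  shows "(\<Sum>i\<in>I. (y i)\<^sup>2) \<le> m * sum y I"
  unfolding sum_distrib_left power2_eq_square using assms
  by (intro sum_mono mult_right_mono) auto

text \<open>A convex function on the polytope of the \<open>y i\<close> with given sum is largest at the vertex
  with one coordinate equal to \<open>m\<close> and another one carrying the rest.\<close>
lemma sum_squares_le_two_point:
  fixes y :: "nat \<Rightarrow> real"
  assumes "finite I" "\<And>i. i \<in> I \<Longrightarrow> 0 \<le> y i" "\<And>i. i \<in> I \<Longrightarrow> y i \<le> m"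
    and "m \<le> sum y I" "sum y I \<le> 2 * m"
  shows "(\<Sum>i\<in>I. (y i)\<^sup>2) \<le> m\<^sup>2 + (sum y I - m)\<^sup>2"
proof (cases "\<exists>p\<in>I. sum y I < 2 * y p")
  case True
  then obtain p where p: "p \<in> I" "sum y I < 2 * y p" by blast
  have s: "sum y I = y p + sum y (I - {p})"
    using assms(1) p by (simp add: sum.remove)
  have n: "0 \<le> sum y (I - {p})"
    using assms(2) by (intro sum_nonneg) auto
  have "(\<Sum>i\<in>I - {p}. (y i)\<^sup>2) \<le> sum y (I - {p}) * sum y (I - {p})"
    using assms(1,2) by (intro sum_squares_le) (auto intro!: member_le_sum)
  then have "(\<Sum>i\<in>I. (y i)\<^sup>2) \<le> (y p)\<^sup>2 + (sum y I - y p)\<^sup>2"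
    using assms(1) p s by (simp add: sum.remove power2_eq_square)
  \<comment> \<open>Twice this product is the change of the two-point sum of squares when the larger
    coordinate moves from \<open>y p\<close> up to \<open>m\<close>.\<close>
  moreover have "0 \<le> (m - y p) * (m + y p - sum y I)"
    using assms(3)[OF p(1)] p(2) by (intro mult_nonneg_nonneg) auto
  ultimately show ?thesis by (simp add: power2_eq_square algebra_simps)
next
  case False
  have "(\<Sum>i\<in>I. (y i)\<^sup>2) \<le> sum y I / 2 * sum y I"
    using assms(1,2) False by (intro sum_squares_le) force+
  moreover have "0 \<le> (sum y I / 2 - m)\<^sup>2" by simp
  ultimately show ?thesis by (simp add: power2_eq_square field_simps)
qed

text \<open>Let \<open>j\<close> be the first index with \<open>x j \<noteq> vseq j\<close>; then \<open>x j \<ge> vseq j + 1\<close>. A larger \<open>e\<^sub>1\<close> with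
  no larger \<open>e\<^sub>2\<close> needs a larger sum of squares, but from \<open>j\<close> on the squares of \<open>1 / x i\<close> add up to
  less than \<open>1 / (vseq j)\<^sup>2\<close> if \<open>j \<ge> 3\<close>; the cases \<open>j \<le> 2\<close> are numerical.\<close>
lemma vseq_sum_max:
  fixes x :: "nat \<Rightarrow> nat"
  defines "y \<equiv> \<lambda>i. 1 / real (x i)" and "w \<equiv> \<lambda>i. 1 / vseq i"
  assumes pos: "\<And>i. i \<in> {1..k} \<Longrightarrow> 0 < x i"
    and mono: "\<And>i j. \<lbrakk>1 \<le> i; i \<le> j; j \<le> k\<rbrakk> \<Longrightarrow> x i \<le> x j"
    and less1: "pair_sum y {1..k} < 1"
    and le: "pair_sum y {1..k} \<le> pair_sum w {1..k}"
  shows "sum y {1..k} \<le> sum w {1..k}"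
proof (rule ccontr)
  assume contr: "\<not> ?thesis"
  have y0: "0 \<le> y i" for i by (simp add: y_def)
  have w0: "0 \<le> w i" if "1 \<le> i" for i
    using vseq_ge_1[OF that] by (simp add: w_def)
  define P where "P i \<longleftrightarrow> i \<in> {1..k} \<and> real (x i) \<noteq> vseq i" for i
  have "\<exists>i. P i"
  proof (rule ccontr)
    assume "\<nexists>i. P i"
    then have "sum y {1..k} = sum w {1..k}"
      by (intro sum.cong) (auto simp: P_def y_def w_def)
    then show False using contr by simp
  qed
  then obtain j where j: "P j" and least: "\<And>i. i < j \<Longrightarrow> \<not> P i"
    using exists_least_iff[of P] by auto
  then obtain m where m: "j = Suc m"
    by (cases j) (auto simp: P_def)
  let ?I = "{1..m}" and ?T = "{j..k}"
  define v where "v = vseq j"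
  define Q where "Q = (\<Prod>i\<in>?I. vseq i)"
  define S where "S = sum w ?I"
  have jk: "1 \<le> j" "j \<le> k" and neq: "real (x j) \<noteq> v"
    using j by (auto simp: P_def v_def)
  have eq: "y i = w i" if "i \<in> ?I" for i
    using least[of i] that m jk by (auto simp: P_def y_def w_def)
  then have sum_y: "sum y ?I = S" and pair_y: "pair_sum y ?I = pair_sum w ?I"
    by (auto simp: S_def intro: pair_sum_cong)
  have Q1: "1 \<le> Q"
    unfolding Q_def by (rule prod_vseq_ge_1)
  have D: "1 - pair_sum w ?I = 1 / Q"
    unfolding w_def Q_def by (rule prod_vseq_pair_sum)
  have v: "v = 1 + Q * S"
    unfolding v_def m Q_def S_def w_def by (rule vseq_Suc_prod)
  have S0: "0 \<le> S"
    unfolding S_def by (intro sum_nonneg w0) auto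
  have v1: "1 \<le> v"
    using v S0 Q1 by simp
  have xj: "0 < real (x j)"
    using pos[of j] jk by simp
  \<comment> \<open>The common prefix has defect \<open>1 / Q\<close>, so a pair sum below 1 for the
    first \<open>j\<close> terms forces \<open>x j > Q * S = v - 1\<close>. Integrality and
    \<open>x j \<noteq> v\<close> then raise this to \<open>v + 1\<close>.\<close>
  have "pair_sum y {1..j} \<le> pair_sum y {1..k}"
    using jk y0 by (intro pair_sum_mono_set) auto
  then have "pair_sum w ?I + S * y j < 1"
    using less1 pair_sum_Suc[of y m] by (simp only: m sum_y pair_y)
  then have "S / real (x j) < 1 / Q"
    using D by (simp add: y_def)
  then have "v - 1 < real (x j)"
    using xj Q1 v by (simp add: field_simps)
  moreover obtain z where z: "v = of_int z"
    using vseq_Ints[of j] unfolding v_def by (auto elim: Ints_cases)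
  ultimately have "z - 1 < int (x j)" "z \<noteq> int (x j)"
    using neq by auto
  then have "v + 1 \<le> real (x j)"
    unfolding z by linarith
  then have xT: "v + 1 \<le> real (x i)" if "i \<in> ?T" for i
    using mono[of j i] that jk by fastforce
  have yT: "y i \<le> 1 / (v + 1)" if "i \<in> ?T" for i
    unfolding y_def using xT[OF that] v1 by (intro divide_left_mono) auto
  have un: "{1..k} = ?I \<union> ?T"
    using m jk by auto
  define W where "W = sum y ?T"
  define W' where "W' = sum w ?T"
  define q where "q = (\<Sum>i\<in>?T. (y i)\<^sup>2)"
  have W'0: "0 \<le> W'"
    unfolding W'_def using jk by (intro sum_nonneg w0) auto
  have sums: "sum y {1..k} = S + W" "sum w {1..k} = S + W'"
    unfolding un W_def W'_def using m sum_y by (auto simp: sum.union_disjoint S_def)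
  then have W: "W' < W"
    using contr by simp
  have pair: "pair_sum y {1..k} = pair_sum w ?I + S * W + pair_sum y ?T"
      "pair_sum w {1..k} = pair_sum w ?I + S * W' + pair_sum w ?T"
    unfolding un W_def W'_def using m pair_y sum_y by (auto simp: pair_sum_Un S_def)
  have ET: "pair_sum y ?T = (W\<^sup>2 - q) / 2" "pair_sum w ?T = (W'\<^sup>2 - (\<Sum>i\<in>?T. (w i)\<^sup>2)) / 2"
    by (simp_all add: pair_sum_def W_def W'_def q_def)
  have bound: "S * W + (W\<^sup>2 - q) / 2 < 1 / Q"
    using less1 D unfolding pair ET by simp
  have "S * W' \<le> S * W"
    using W S0 by (intro mult_left_mono) auto
  then have "pair_sum y ?T \<le> pair_sum w ?T"
    using le unfolding pair by simp
  moreover have "W'\<^sup>2 < W\<^sup>2"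
    using W W'0 by (intro power_strict_mono) auto
  ultimately have "(\<Sum>i\<in>?T. (w i)\<^sup>2) < q"
    unfolding ET by simp
  moreover have "(w j)\<^sup>2 \<le> (\<Sum>i\<in>?T. (w i)\<^sup>2)"
    using jk by (intro member_le_sum) auto
  ultimately have q: "1 / v\<^sup>2 < q"
    by (simp add: w_def v_def power_divide)
  have q_le: "q \<le> 1 / (v + 1) * W"
    unfolding q_def W_def using y0 yT by (intro sum_squares_le) auto
  have W_card: "W \<le> (real k - real m) / (v + 1)"
    using sum_bounded_above[of ?T y "1 / (v + 1)"] yT m jk
    by (simp add: W_def of_nat_diff)
  have W'_sub: "sum w {j..i} \<le> W'" if "i \<le> k" for i
    unfolding W'_def using that jk by (intro sum_mono2 w0) auto
  consider "j = 1" | "j = 2" | "3 \<le> j"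
    using jk by linarith
  then show False
  proof cases
    case 1
    then have [simp]: "v = 1" "S = 0" "Q = 1" "m = 0"
      using m by (auto simp: v_def S_def Q_def vseq_first_terms(1)[unfolded One_nat_def])
    consider "k = 1" | "k = 2" | "3 \<le> k"
      using jk by linarith
    then show False
    proof cases
      case 1
      then show False
        using W_card W W'_sub[of 1] \<open>j = 1\<close> by (simp add: w_def vseq_first_terms(1)[unfolded One_nat_def])
    next
      case 2
      then show False
        using W_card W W'_sub[of 2] \<open>j = 1\<close> vseq_first_terms by (simp add: w_def numeral_eq_Suc)
    next
      case 3
      \<comment> \<open>7/4 = 1 + 1/2 + 1/4 comes from the first three terms of v. It gives
        \<open>W * (W - 1 / 2) >= 35/16\<close>, whereas \<open>bound\<close> and
        \<open>q_le\<close> force a value below 2.\<close>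
      then have "7 / 4 < W"
        using W W'_sub[of 3] \<open>j = 1\<close> vseq_first_terms by (simp add: w_def numeral_eq_Suc)
      then have "7 / 4 * (5 / 4) \<le> W * (W - 1 / 2)"
        by (intro mult_mono) auto
      also have "\<dots> = W\<^sup>2 - 1 / 2 * W"
        by (simp add: power2_eq_square right_diff_distrib)
      finally have "7 / 4 * (5 / 4) \<le> W\<^sup>2 - 1 / 2 * W" .
      moreover have "(W\<^sup>2 - q) / 2 < 1" "q \<le> 1 / 2 * W"
        using bound q_le by simp_all
      ultimately show False
        by (simp add: field_simps)
    qed
  next
    case 2
    then have [simp]: "v = 2" "S = 1" "Q = 1" "m = 1"
      using m vseq_first_terms(1,2) by (auto simp: v_def S_def Q_def w_def numeral_2_eq_2)
    consider "k = 2" | "k = 3" | "4 \<le> k"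
      using jk 2 by linarith
    then show False
    proof cases
      case 1
      then show False
        using W_card W W'_sub[of 2] \<open>j = 2\<close> vseq_first_terms by (simp add: w_def numeral_eq_Suc)
    next
      case 2
      then show False
        using W_card W W'_sub[of 3] \<open>j = 2\<close> vseq_first_terms by (simp add: w_def numeral_eq_Suc)
    next
      case 3
      \<comment> \<open>49/60 = 1/2 + 1/4 + 1/15 comes from the second to fourth terms of v. It
        gives \<open>W * (W + 5 / 3) >= 7301/3600\<close>, again against a value below 2.\<close>
      then have "49 / 60 < W"
        using W W'_sub[of 4] \<open>j = 2\<close> vseq_first_terms by (simp add: w_def numeral_eq_Suc)
      then have "49 / 60 * (49 / 60 + 5 / 3) \<le> W * (W + 5 / 3)"
        by (intro mult_mono) auto
      also have "\<dots> = W\<^sup>2 + 5 / 3 * W"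
        by (simp add: power2_eq_square distrib_left)
      finally have "49 / 60 * (49 / 60 + 5 / 3) \<le> W\<^sup>2 + 5 / 3 * W" .
      moreover have "W + (W\<^sup>2 - q) / 2 < 1" "q \<le> 1 / 3 * W"
        using bound q_le by simp_all
      ultimately show False
        by (simp add: field_simps)
    qed
  next
    case 3
    have v4: "4 \<le> v"
      unfolding v_def using vseq_ge_4[OF 3] .
    have "0 \<le> pair_sum y ?T"
      using y0 by (intro pair_sum_nonneg) auto
    then have "S * W < 1 / Q"
      using bound unfolding ET(1)[symmetric] by linarith
    then have "(v - 1) * W < 1"
      using v Q1 by (simp add: field_simps)
    then have W_less: "W < 1 / (v - 1)"
      using v4 by (simp add: field_simps)
    have frac: "1 / (v - 1) - 1 / (v + 1) = 2 / (v\<^sup>2 - 1)" "2 / (v\<^sup>2 - 1) \<le> 1 / (v + 1)"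
    proof -
      have "v\<^sup>2 - 1 = (v - 1) * (v + 1)" by (simp add: power2_eq_square algebra_simps)
      moreover have "1 / (v - 1) - 1 / (v + 1) = 2 / ((v - 1) * (v + 1))"
        using v4 by (simp add: diff_frac_eq)
      moreover have "2 / (v - 1) * (1 / (v + 1)) \<le> 1 * (1 / (v + 1))"
        using v4 by (intro mult_right_mono) auto
      ultimately show "1 / (v - 1) - 1 / (v + 1) = 2 / (v\<^sup>2 - 1)" "2 / (v\<^sup>2 - 1) \<le> 1 / (v + 1)"
        by simp_all
    qed
    \<comment> \<open>Every entry is at most \<open>1 / (v + 1)\<close> and the total is below
      \<open>1 / (v - 1)\<close>, so after one full entry at most \<open>2 / (v\<^sup>2 - 1)\<close>
      remains; this is the two-point configuration.\<close>
    have "q \<le> (1 / (v + 1))\<^sup>2 + (2 / (v\<^sup>2 - 1))\<^sup>2"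
    proof (cases "W \<le> 1 / (v + 1)")
      case True
      then have "1 / (v + 1) * W \<le> 1 / (v + 1) * (1 / (v + 1))"
        using v4 by (intro mult_left_mono) auto
      then show ?thesis
        using q_le by (simp add: power2_eq_square add_increasing2)
    next
      case False
      have "q \<le> (1 / (v + 1))\<^sup>2 + (W - 1 / (v + 1))\<^sup>2"
        unfolding q_def W_def
        using False W_less frac y0 yT W_def by (intro sum_squares_le_two_point) auto
      moreover have "(W - 1 / (v + 1))\<^sup>2 \<le> (2 / (v\<^sup>2 - 1))\<^sup>2"
        using False W_less frac by (intro power_mono) auto
      ultimately show ?thesis by simp
    qed
    also have "\<dots> = ((v - 1)\<^sup>2 + 4) / (v\<^sup>2 - 1)\<^sup>2"
    proof -
      have "v\<^sup>2 - 1 = (v - 1) * (v + 1)" by (simp add: power2_eq_square algebra_simps)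
      then show ?thesis
        using v4 by (simp add: power_divide power_mult_distrib add_divide_distrib)
    qed
    also have "\<dots> \<le> 1 / v\<^sup>2"
    proof -
      have sq: "16 \<le> v\<^sup>2"
        using power_mono[OF v4, of 2] by simp
      \<comment> \<open>The two sides of the next inequality differ by this term plus
        \<open>v\<^sup>2 + 1\<close>.\<close>
      have "0 \<le> v\<^sup>2 * (2 * v - 8)"
        using v4 by simp
      then have "v\<^sup>2 * ((v - 1)\<^sup>2 + 4) \<le> (v\<^sup>2 - 1)\<^sup>2"
        using sq by (simp add: power2_eq_square algebra_simps)
      moreover have "0 < (v\<^sup>2 - 1)\<^sup>2" "0 < v\<^sup>2"
        using sq by auto
      ultimately show ?thesis
        by (simp add: field_simps)
    qed
    finally show False
      using q by simp
  qed
qed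

text \<open>Sum and pair sum go through the induction together, since the pair sum of prefix and
  tail combined contains the product of their sums.\<close>

lemma vseq_extremal:
  fixes x :: "nat \<Rightarrow> nat"
  assumes "\<And>i. i \<in> {1..k} \<Longrightarrow> 0 < x i"
    and "\<And>i j. \<lbrakk>1 \<le> i; i \<le> j; j \<le> k\<rbrakk> \<Longrightarrow> x i \<le> x j"
    and "pair_sum (\<lambda>i. 1 / real (x i)) {1..k} < 1"
  shows "(\<Sum>i\<in>{1..k}. 1 / real (x i)) \<le> (\<Sum>i\<in>{1..k}. 1 / vseq i)
    \<and> pair_sum (\<lambda>i. 1 / real (x i)) {1..k} \<le> pair_sum (\<lambda>i. 1 / vseq i) {1..k}"
  using assms
proof (induction k rule: less_induct)
  case (less k)
  note pos = less.prems(1) and mono = less.prems(2) and less1 = less.prems(3)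
  let ?x = "\<lambda>i. real (x i)"
  let ?y = "\<lambda>i. 1 / real (x i)" and ?w = "\<lambda>i. 1 / vseq i"
  define M where "M = {i \<in> {1..k}. prod vseq {i..k} \<le> prod ?x {i..k}}"
  show ?case
  proof (cases "M = {}")
    case False
    define i where "i = Max M"
    have "finite M" by (simp add: M_def)
    then have "i \<in> M" and max: "\<And>t. t \<in> M \<Longrightarrow> t \<le> i"
      using False by (auto simp: i_def)
    then have i: "1 \<le> i" "i \<le> k" and ge: "prod vseq {i..k} \<le> prod ?x {i..k}"
      by (auto simp: M_def)
    \<comment> \<open>By maximality of \<open>i\<close>, every shorter tail has a smaller product
      for \<open>x\<close> than for v. Cancelling the tail after \<open>t\<close> turns the
      comparison on \<open>{i..k}\<close> into one on \<open>{i..t}\<close>.\<close>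
    have dom: "prod ?y {i..t} \<le> prod ?w {i..t}" if t: "t \<in> {i..k}" for t
    proof -
      have v_pos: "0 < prod vseq {s..t}" if "1 \<le> s" for s t
        using that vseq_ge_1 by (intro prod_pos) (force intro: less_le_trans[OF zero_less_one])
      have "prod vseq {i..t} \<le> prod ?x {i..t}"
      proof (cases "t = k")
        case False
        then have "Suc t \<notin> M"
          using max t by fastforce
        then have "prod ?x {Suc t..k} \<le> prod vseq {Suc t..k}"
          using False t i by (auto simp: M_def)
        then have "prod ?x {i..t} * prod ?x {Suc t..k} \<le> prod ?x {i..t} * prod vseq {Suc t..k}"
          by (intro mult_left_mono prod_nonneg) auto
        moreover have "prod f {i..k} = prod f {i..t} * prod f {Suc t..k}" for f :: "nat \<Rightarrow> real"
          using t prod.ub_add_nat[of i t f "k - t"] by simp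
        ultimately have "prod vseq {i..t} * prod vseq {Suc t..k} \<le> prod ?x {i..t} * prod vseq {Suc t..k}"
          using ge by simp
        then show ?thesis
          using v_pos[of "Suc t" k] by (simp add: mult_le_cancel_right)
      qed (use ge in simp)
      then show ?thesis
        using v_pos[OF i(1), of t] by (simp add: prod_dividef frac_le)
    qed
    have x_pos: "0 < ?x t" if "t \<in> {i..k}" for t
      using that i pos[of t] by simp
    have tail: "sum ?y {i..k} \<le> sum ?w {i..k}" "pair_sum ?y {i..k} \<le> pair_sum ?w {i..k}"
    proof (atomize (full), intro conjI)
      have 1: "0 < ?y t" if "t \<in> {i..k}" for t
        using x_pos[OF that] by simp
      have 2: "0 < ?w t" if "t \<in> {i..k}" for t
        using vseq_ge_1[of t] that i by simp
      have 3: "?y t \<le> ?y s" if "i \<le> s" "s \<le> t" "t \<le> k" for s t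
        using mono[of s t] x_pos[of s] that i by (intro divide_left_mono) auto
      show "sum ?y {i..k} \<le> sum ?w {i..k}"
        by (rule log_majorization(1)[OF i(2) 1 2 3 dom])
      show "pair_sum ?y {i..k} \<le> pair_sum ?w {i..k}"
        by (rule log_majorization(2)[OF i(2) 1 2 3 dom])
    qed
    have "pair_sum ?y {1..i - 1} \<le> pair_sum ?y {1..k}"
      using i by (intro pair_sum_mono_set) auto
    then have prefix: "sum ?y {1..i - 1} \<le> sum ?w {1..i - 1}
        \<and> pair_sum ?y {1..i - 1} \<le> pair_sum ?w {1..i - 1}"
      using less1 i pos mono by (intro less.IH) auto
    have un: "{1..k} = {1..i - 1} \<union> {i..k}" and disj: "{1..i - 1} \<inter> {i..k} = {}"
      using i by auto
    have split: "sum f {1..k} = sum f {1..i - 1} + sum f {i..k}"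
        "pair_sum f {1..k} = pair_sum f {1..i - 1} + sum f {1..i - 1} * sum f {i..k} + pair_sum f {i..k}"
      for f :: "nat \<Rightarrow> real"
      unfolding un using disj by (auto simp: sum.union_disjoint pair_sum_Un)
    have "sum ?y {1..i - 1} * sum ?y {i..k} \<le> sum ?w {1..i - 1} * sum ?w {i..k}"
      using prefix tail(1) vseq_ge_1
      by (intro mult_mono sum_nonneg) (force intro: order_trans[OF zero_le_one])+
    then show ?thesis
      unfolding split using prefix tail by linarith
  next
    case True
    have "pair_sum ?y {1..k} \<le> pair_sum ?w {1..k}"
    proof (cases "k = 0")
      case False
      let ?P = "prod ?x {1..k}" and ?Q = "prod vseq {1..k}"
      have "1 \<notin> M" using True by simp
      then have less: "?P < ?Q"
        using False by (auto simp: M_def)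
      have P: "0 < ?P"
        using pos by (intro prod_pos) auto
      have "?P * pair_sum ?y {1..k} \<in> \<int>"
        using pos by (intro prod_mult_pair_sum_Ints) auto
      moreover have "?P \<in> \<int>"
        by (intro Ints_prod) auto
      ultimately have "?P * (1 - pair_sum ?y {1..k}) \<in> \<int>"
        unfolding right_diff_distrib by simp
      then obtain z where z: "?P * (1 - pair_sum ?y {1..k}) = of_int z"
        by (auto elim: Ints_cases)
      moreover have "0 < ?P * (1 - pair_sum ?y {1..k})"
        using P less1 by simp
      ultimately have "1 \<le> ?P * (1 - pair_sum ?y {1..k})"
        by simp
      then have "1 / ?P \<le> 1 - pair_sum ?y {1..k}"
        using P by (simp only: divide_le_eq mult.commute) simp
      moreover have "1 / ?Q \<le> 1 / ?P"
        using less P by (intro divide_left_mono) auto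
      ultimately show ?thesis
        using prod_vseq_pair_sum[of k] by linarith
    qed simp
    moreover from this have "sum ?y {1..k} \<le> sum ?w {1..k}"
      using pos mono less1 by (intro vseq_sum_max)
    ultimately show ?thesis by blast
  qed
qed

section \<open>Growth of the next term and products of prefixes\<close>

text \<open>Let m = n - k. The later reciprocals are at most Y, the next one, so the pairs involving
  them contribute at most m Y S + m (m - 1) Y Y / 2. Replacing one Y by the average S / k of the
  first k reciprocals makes this linear in Y, and it can be solved for the next term.\<close>

lemma next_term_bound:
  fixes x :: "nat \<Rightarrow> nat"
  defines "y \<equiv> \<lambda>i. 1 / real (x i)"
  assumes k: "1 \<le> k" "k < n"
    and pos: "\<And>i. i \<in> {1..n} \<Longrightarrow> 0 < x i"
    and mono: "\<And>i j. \<lbrakk>1 \<le> i; i \<le> j; j \<le> n\<rbrakk> \<Longrightarrow> x i \<le> x j"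
    and one: "pair_sum y {1..n} = 1"
  shows "pair_sum y {1..k} < 1"
    and "real (x (Suc k)) \<le> (real (n - k) * real (n + k - 1) / (2 * real k))
      * (sum y {1..k} / (1 - pair_sum y {1..k}))"
proof -
  let ?I = "{1..k}" and ?T = "{Suc k..n}"
  define m where "m = real (n - k)"
  define Y where "Y = y (Suc k)"
  define S where "S = sum y ?I"
  have m: "1 \<le> m" "card ?T = n - k" "real (card ?T) = m"
    using k by (auto simp: m_def)
  have y_pos: "0 < y i" if "i \<in> {1..n}" for i
    using pos[OF that] by (simp add: y_def)
  have dec: "y j \<le> y i" if "1 \<le> i" "i \<le> j" "j \<le> n" for i j
    unfolding y_def using mono[OF that] pos[of i] pos[of j] that by (intro divide_left_mono) auto
  have un: "{1..n} = ?I \<union> ?T"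
    using k by auto
  have split: "pair_sum y ?I + S * sum y ?T + pair_sum y ?T = 1"
    using one unfolding un S_def by (subst (asm) pair_sum_Un) auto
  have Y: "0 < Y"
    unfolding Y_def using k by (intro y_pos) auto
  have kY: "k * Y \<le> S"
    unfolding S_def Y_def using k dec sum_bounded_below[of ?I Y y] by (auto simp: Y_def)
  then have YS: "Y \<le> S / k"
    using kY k by (simp add: field_simps)
  have "0 < k * Y"
    using Y k by simp
  then have S: "0 < S"
    using kY by linarith
  have T: "sum y ?T \<le> m * Y"
    using sum_bounded_above[of ?T y Y] dec k m(3) unfolding Y_def by auto
  have "0 < sum y ?T"
    using k y_pos by (intro sum_pos) auto
  then have "0 < S * sum y ?T"
    using S by simp
  moreover have "0 \<le> pair_sum y ?T"
    using y_pos k by (intro pair_sum_nonneg) (auto intro: less_imp_le)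
  ultimately show less1: "pair_sum y ?I < 1"
    using split by linarith
  have "2 * pair_sum y ?T \<le> (\<Sum>i\<in>?T. \<Sum>j\<in>?T - {i}. Y * Y)"
    unfolding pair_sum_double[OF finite_atLeastAtMost] using Y dec k y_pos
    by (intro sum_mono mult_mono) (auto simp: Y_def intro: less_imp_le)
  also have "\<dots> = (\<Sum>i\<in>?T. (m - 1) * (Y * Y))"
    using k by (intro sum.cong refl) (auto simp: m_def of_nat_diff)
  also have "\<dots> = m * (m - 1) * Y * Y"
    using m(3) by simp
  finally have E: "pair_sum y ?T \<le> m * (m - 1) / 2 * Y * Y"
    by simp
  have "1 - pair_sum y ?I = S * sum y ?T + pair_sum y ?T"
    using split by simp
  also have "\<dots> \<le> S * (m * Y) + m * (m - 1) / 2 * Y * Y"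
    using T E S by (intro add_mono mult_left_mono) auto
  also have "\<dots> \<le> S * (m * Y) + m * (m - 1) / 2 * Y * (S / k)"
    using YS Y m S by (intro add_mono mult_left_mono) auto
  also have "\<dots> = m * (2 * k + m - 1) / (2 * k) * S * Y"
    using k by (simp add: field_simps)
  also have "2 * k + m - 1 = real (n + k - 1)"
    using k by (simp add: m_def of_nat_diff)
  finally have "1 - pair_sum y ?I \<le> m * real (n + k - 1) / (2 * k) * S / real (x (Suc k))"
    by (simp add: Y_def y_def)
  then have "(1 - pair_sum y ?I) * real (x (Suc k)) \<le> m * real (n + k - 1) / (2 * k) * S"
    using pos[of "Suc k"] k by (subst (asm) pos_le_divide_eq) auto
  then show "real (x (Suc k)) \<le> (real (n - k) * real (n + k - 1) / (2 * real k))
      * (sum y {1..k} / (1 - pair_sum y {1..k}))"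
    using less1 unfolding S_def[symmetric] m_def[symmetric] times_divide_eq_right
    by (subst pos_le_divide_eq) (simp_all only: mult.commute diff_gt_0_iff_gt)
qed

text \<open>The factors n - k build a quotient of factorials, and the factors (n + k - 1) / k build
  the binomial coefficient.\<close>

lemma prod_growth:
  assumes "1 \<le> n" "K < n"
  shows "(\<Prod>k\<in>{1..K}. real (n - k) * real (n + k - 1) / (2 * real k)) * fact (n - 1 - K) * 2 ^ K
    = fact (n - 1) * real ((n + K - 1) choose K)"
  using assms(2)
proof (induction K)
  case (Suc K)
  define A where "A = (\<Prod>k\<in>{1..K}. real (n - k) * real (n + k - 1) / (2 * real k))"
  have f: "fact (n - 1 - K) = real (n - Suc K) * fact (n - 1 - Suc K)"
    using Suc.prems by (subst fact_reduce) auto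
  have "Suc K * ((n + K) choose Suc K) = (n + K) * ((n + K - 1) choose K)"
    using Suc_times_binomial_eq[of "n + K - 1" K] assms(1) by simp
  then have c: "real (Suc K) * real ((n + K) choose Suc K) = real (n + K) * real ((n + K - 1) choose K)"
    by (metis of_nat_mult)
  have "A * (real (n - Suc K) * real (n + K) / (2 * real (Suc K))) * fact (n - 1 - Suc K) * 2 ^ Suc K
      = (A * fact (n - 1 - K) * 2 ^ K) * real (n + K) / real (Suc K)"
    unfolding f by (simp add: field_simps)
  also have "A * fact (n - 1 - K) * 2 ^ K = fact (n - 1) * real ((n + K - 1) choose K)"
    unfolding A_def using Suc by simp
  also have "fact (n - 1) * real ((n + K - 1) choose K) * real (n + K) / real (Suc K)
      = fact (n - 1) * (real (Suc K) * real ((n + K) choose Suc K)) / real (Suc K)"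
    unfolding c by simp
  also have "\<dots> = fact (n - 1) * real ((n + K) choose Suc K)"
    by simp
  finally show ?case
    by (simp add: A_def)
qed simp

text \<open>The induction starts with two terms, because \<open>next_term_bound\<close> for
  \<open>k = 1\<close> controls the product of \<open>x 1\<close> and \<open>x 2\<close>. Hence
  \<open>K\<close> growth factors accompany \<open>Suc K\<close> terms.\<close>

lemma prod_prefix_bound:
  fixes x :: "nat \<Rightarrow> nat"
  assumes pos: "\<And>i. i \<in> {1..n} \<Longrightarrow> 0 < x i"
    and mono: "\<And>i j. \<lbrakk>1 \<le> i; i \<le> j; j \<le> n\<rbrakk> \<Longrightarrow> x i \<le> x j"
    and one: "pair_sum (\<lambda>i. 1 / real (x i)) {1..n} = 1"
    and "1 \<le> K" "K < n"
  shows "(\<Prod>i\<in>{1..Suc K}. real (x i))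
    \<le> (\<Prod>k\<in>{1..K}. real (n - k) * real (n + k - 1) / (2 * real k)) * (\<Prod>i\<in>{1..Suc K}. vseq i)"
  using assms(4,5)
proof (induction K rule: dec_induct)
  case base
  then have "real (x (Suc 1)) \<le> (real (n - 1) * real (n + 1 - 1) / (2 * real 1))
      * ((\<Sum>i\<in>{1..1}. 1 / real (x i)) / (1 - pair_sum (\<lambda>i. 1 / real (x i)) {1..1}))"
    using pos mono one by (intro next_term_bound(2)) auto
  then have "real (x 1) * real (x 2) \<le> real (n - 1) * real n / 2"
    using pos[of 1] base by (simp add: pair_sum_def field_simps numeral_2_eq_2)
  moreover have "0 \<le> real (n - 1) * real n"
    by simp
  ultimately have "real (x 1) * real (x 2) \<le> real (n - 1) * real n"
    by linarith
  moreover have "{1..Suc 1} = {1, 2::nat}" by auto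
  ultimately show ?case
    using vseq_first_terms(1,2) by simp
next
  case (step K)
  let ?k = "Suc K"
  let ?y = "\<lambda>i. 1 / real (x i)" and ?w = "\<lambda>i. 1 / vseq i"
  let ?g = "\<lambda>k. real (n - k) * real (n + k - 1) / (2 * real k)"
  have less1: "pair_sum ?y {1..?k} < 1"
    using step.prems pos mono one by (intro next_term_bound(1)[where n = n]) auto
  have ext: "sum ?y {1..?k} \<le> sum ?w {1..?k} \<and> pair_sum ?y {1..?k} \<le> pair_sum ?w {1..?k}"
    using step.prems pos mono less1 by (intro vseq_extremal) auto
  have "0 < 1 - pair_sum ?w {1..?k}"
    using prod_vseq_pair_sum[of ?k] prod_vseq_ge_1[of ?k] by simp
  moreover have "0 \<le> sum ?y {1..?k}"
    by (intro sum_nonneg) auto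
  \<comment> \<open>Extremality enlarges the numerator and shrinks the denominator; the right-hand
    side is \<open>vseq (Suc ?k) - 1\<close>.\<close>
  ultimately have "sum ?y {1..?k} / (1 - pair_sum ?y {1..?k}) \<le> sum ?w {1..?k} / (1 - pair_sum ?w {1..?k})"
    using ext by (intro frac_le) linarith+
  also have "\<dots> \<le> vseq (Suc ?k)"
    using vseq_Suc[of ?k] by simp
  finally have "?g ?k * (sum ?y {1..?k} / (1 - pair_sum ?y {1..?k})) \<le> ?g ?k * vseq (Suc ?k)"
    by (intro mult_left_mono) auto
  moreover have "real (x (Suc ?k)) \<le> ?g ?k * (sum ?y {1..?k} / (1 - pair_sum ?y {1..?k}))"
    using step.prems pos mono one by (intro next_term_bound(2)) auto
  ultimately have next_le: "real (x (Suc ?k)) \<le> ?g ?k * vseq (Suc ?k)"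
    by linarith
  have IH: "(\<Prod>i\<in>{1..?k}. real (x i)) \<le> prod ?g {1..K} * prod vseq {1..?k}"
    using step by auto
  have "(\<Prod>i\<in>{1..?k}. real (x i)) * real (x (Suc ?k))
      \<le> (prod ?g {1..K} * prod vseq {1..?k}) * (?g ?k * vseq (Suc ?k))"
    by (intro mult_mono IH next_le order_trans[OF _ IH] prod_nonneg of_nat_0_le_iff ballI)
  moreover have "prod f {1..Suc i} = prod f {1..i} * f (Suc i)" for f :: "nat \<Rightarrow> real" and i
    by simp
  ultimately show ?case
    by (simp only: mult_ac)
qed

section \<open>The lower bound\<close>

text \<open>AM-GM in logarithmic form: apply ln t <= t - 1 to t = C / (z_i z_j) and sum over the 2 C
  ordered pairs. The right-hand sides add up to 0, and each ln z_i occurs 2 (n - 1) times.\<close>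

lemma am_gm_pair_sum:
  fixes z :: "nat \<Rightarrow> real"
  assumes "2 \<le> n" "\<And>i. i \<in> {1..n} \<Longrightarrow> 0 < z i"
    and one: "pair_sum (\<lambda>i. 1 / z i) {1..n} = 1"
  shows "real (n choose 2) powr (real n / 2) \<le> (\<Prod>i\<in>{1..n}. z i)"
proof -
  let ?I = "{1..n}"
  define C where "C = real (n choose 2)"
  have C: "2 * C = real n * (real n - 1)"
    unfolding C_def using assms(1)
    by (simp add: binomial_gbinomial gbinomial_prod_rev numeral_2_eq_2)
  moreover have "0 < real n * (real n - 1)"
    using assms(1) by (intro mult_pos_pos) auto
  ultimately have C_pos: "0 < C"
    by linarith
  define L where "L = (\<Sum>i\<in>?I. ln (z i))"
  have card: "real (card (?I - {i})) = real n - 1" if "i \<in> ?I" for i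
    using that by (simp add: of_nat_diff)
  have const: "(\<Sum>i\<in>?I. \<Sum>j\<in>?I - {i}. c) = 2 * C * c" for c :: real
  proof -
    have "(\<Sum>i\<in>?I. \<Sum>j\<in>?I - {i}. c) = (\<Sum>i\<in>?I. (real n - 1) * c)"
      using card by (intro sum.cong refl) simp
    then show ?thesis by (simp add: C)
  qed
  have row: "(\<Sum>j\<in>?I - {i}. ln (z i) + ln (z j)) = (real n - 2) * ln (z i) + L" if "i \<in> ?I" for i
    using that card[OF that] by (simp add: sum.distrib L_def sum_diff1 algebra_simps)
  have "(\<Sum>i\<in>?I. \<Sum>j\<in>?I - {i}. ln (z i) + ln (z j)) = (\<Sum>i\<in>?I. (real n - 2) * ln (z i) + L)"
    using row by (intro sum.cong refl)
  also have "\<dots> = (real n - 2) * L + real n * L"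
    by (simp add: sum.distrib sum_distrib_left[symmetric] L_def)
  finally have logs: "(\<Sum>i\<in>?I. \<Sum>j\<in>?I - {i}. ln (z i) + ln (z j)) = 2 * (real n - 1) * L"
    by (simp add: algebra_simps)
  have "(\<Sum>i\<in>?I. \<Sum>j\<in>?I - {i}. ln C - (ln (z i) + ln (z j)))
      \<le> (\<Sum>i\<in>?I. \<Sum>j\<in>?I - {i}. C * (1 / z i * (1 / z j)) - 1)"
  proof (intro sum_mono)
    fix i j assume "i \<in> ?I" "j \<in> ?I - {i}"
    then have z: "0 < z i" "0 < z j"
      using assms(2) by auto
    then have "ln (C / (z i * z j)) \<le> C / (z i * z j) - 1"
      using C_pos by (intro ln_le_minus_one) simp
    then show "ln C - (ln (z i) + ln (z j)) \<le> C * (1 / z i * (1 / z j)) - 1"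
      using z C_pos by (simp add: ln_div ln_mult)
  qed
  then have "2 * C * ln C - 2 * (real n - 1) * L \<le> C * (2 * pair_sum (\<lambda>i. 1 / z i) ?I) - 2 * C"
    unfolding pair_sum_double[OF finite_atLeastAtMost] sum_subtractf const logs
    by (simp add: sum_distrib_left)
  then have "real n * (real n - 1) * ln C \<le> 2 * (real n - 1) * L"
    using one C by simp
  moreover have "real n * (real n - 1) * ln C = 2 * ((real n - 1) * (real n / 2 * ln C))"
    by simp
  ultimately have "(real n - 1) * (real n / 2 * ln C) \<le> (real n - 1) * L"
    by linarith
  then have "real n / 2 * ln C \<le> L"
    using assms(1) by simp
  then have "C powr (real n / 2) \<le> exp L"
    using C_pos by (simp add: powr_def)
  also have "exp L = (\<Prod>i\<in>?I. z i)"
    unfolding L_def exp_sum[OF finite_atLeastAtMost] using assms(2) by (intro prod.cong) auto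
  finally show ?thesis
    by (simp add: C_def)
qed

theorem corollary12:
  fixes n :: nat and x :: "nat \<Rightarrow> nat"
  assumes "n \<ge> 3"
    and "\<forall>i\<in>{1..n}. 0 < x i"
    and "\<forall>i\<in>{1..n}. \<forall>j\<in>{1..n}. i \<le> j \<longrightarrow> x i \<le> x j"
    and "elem_sym (n - 2) n x = elem_sym n n x"
  shows "real (n choose 2) powr (real n / 2) \<le> real (\<Prod>i\<in>{1..n}. x i)
       \<and> real (\<Prod>i\<in>{1..n}. x i) \<le> 2 ^ (n - 1) * fact n * (\<Prod>i\<in>{1..n}. vseq i)
       \<and> real (\<Prod>i\<in>{1..n-2}. x i) \<le> 2 ^ (n - 2) * fact (n - 1) * (\<Prod>i\<in>{1..n-2}. vseq i)"
proof -
  let ?y = "\<lambda>i. 1 / real (x i)"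
  let ?g = "\<lambda>k. real (n - k) * real (n + k - 1) / (2 * real k)"
  have pos: "\<And>i. i \<in> {1..n} \<Longrightarrow> 0 < x i"
    and mono: "\<And>i j. \<lbrakk>1 \<le> i; i \<le> j; j \<le> n\<rbrakk> \<Longrightarrow> x i \<le> x j"
    using assms(2,3) by auto
  have P: "0 < (\<Prod>i\<in>{1..n}. real (x i))"
    using pos by (intro prod_pos) auto
  have "real (elem_sym (n - 2) n x) = elem_sym (n - 2) n (\<lambda>i. real (x i))"
    by (simp add: elem_sym_def)
  also have "\<dots> = (\<Prod>i\<in>{1..n}. real (x i)) * pair_sum ?y {1..n}"
    using assms(1) pos by (intro elem_sym_minus_2) auto
  finally have "(\<Prod>i\<in>{1..n}. real (x i)) * pair_sum ?y {1..n} = (\<Prod>i\<in>{1..n}. real (x i))"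
    unfolding assms(4) elem_sym_top by simp
  then have one: "pair_sum ?y {1..n} = 1"
    using P by (metis less_irrefl mult_cancel_left2)
  have choose_le: "real (a choose b) \<le> 2 ^ a" for a b
    using binomial_le_pow2[of a b] by (metis of_nat_le_iff of_nat_numeral of_nat_power)
  have lower: "real (n choose 2) powr (real n / 2) \<le> (\<Prod>i\<in>{1..n}. real (x i))"
    using assms(1) pos one by (intro am_gm_pair_sum) auto
  \<comment> \<open>The binomial coefficient is at most \<open>2 ^ (n + K - 1)\<close>, and
    \<open>2 ^ K\<close> cancels.\<close>
  have growth: "prod ?g {1..K} * fact (n - 1 - K) \<le> fact (n - 1) * 2 ^ (n - 1)" if "K < n" for K
  proof -
    have "prod ?g {1..K} * fact (n - 1 - K) * 2 ^ K = fact (n - 1) * real ((n + K - 1) choose K)"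
      using prod_growth[of n K] that by simp
    also have "\<dots> \<le> fact (n - 1) * 2 ^ (n + K - 1)"
      by (intro mult_left_mono choose_le) auto
    also have "\<dots> = fact (n - 1) * 2 ^ (n - 1) * 2 ^ K"
      using that by (simp add: power_add[symmetric])
    finally show ?thesis
      by (simp only: mult_le_cancel_right) simp
  qed
  have upper1: "(\<Prod>i\<in>{1..n}. real (x i)) \<le> 2 ^ (n - 1) * fact n * prod vseq {1..n}"
  proof -
    have "prod ?g {1..n - 1} \<le> fact (n - 1) * 2 ^ (n - 1)"
      using growth[of "n - 1"] assms(1) by simp
    also have "\<dots> \<le> fact n * 2 ^ (n - 1)"
      by (intro mult_right_mono fact_mono) auto
    finally have g: "prod ?g {1..n - 1} \<le> 2 ^ (n - 1) * fact n"
      by (simp only: mult.commute)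
    have "Suc (n - 1) = n" using assms(1) by simp
    then have "(\<Prod>i\<in>{1..n}. real (x i)) \<le> prod ?g {1..n - 1} * prod vseq {1..n}"
      using prod_prefix_bound[of n x "n - 1"] pos mono one assms(1) by auto
    also have "\<dots> \<le> 2 ^ (n - 1) * fact n * prod vseq {1..n}"
      using g prod_vseq_ge_1[of n] by (intro mult_right_mono) auto
    finally show ?thesis .
  qed
  have upper2: "(\<Prod>i\<in>{1..n - 2}. real (x i)) \<le> 2 ^ (n - 2) * fact (n - 1) * prod vseq {1..n - 2}"
  \<comment> \<open>For \<open>n = 3\<close> the prefix is a single term, below the range of
    \<open>prod_prefix_bound\<close>. There \<open>x 1 >= 2\<close> would make the pair sum at most
    3/4.\<close>
  proof (cases "n = 3")
    case True
    have "{1..n} = insert 3 (insert 2 (insert 1 {}))"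
      using True by auto
    then have eq: "?y 1 * ?y 2 + (?y 1 + ?y 2) * ?y 3 = 1"
      using one by (simp add: pair_sum_insert add.commute)
    have *: "x 1 \<le> x 2" "x 1 \<le> x 3" "0 < x 1"
      using mono pos True by auto
    have "x 1 < 2"
    proof (rule ccontr)
      assume "\<not> x 1 < 2"
      then have h: "?y 1 \<le> 1 / 2" "?y 2 \<le> 1 / 2" "?y 3 \<le> 1 / 2"
        using * by (auto intro!: divide_left_mono)
      then have "?y 1 * ?y 2 + (?y 1 + ?y 2) * ?y 3 \<le> 1 / 2 * (1 / 2) + (1 / 2 + 1 / 2) * (1 / 2)"
        by (intro add_mono mult_mono) auto
      then show False
        unfolding eq by simp
    qed
    then show ?thesis
      using True vseq_first_terms(1) by (simp add: numeral_eq_Suc)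
  next
    case False
    then obtain K where K: "n = K + 3" "1 \<le> K"
      using assms(1) by (metis add.commute le_Suc_ex add_0_right less_one not_le)
    \<comment> \<open>With \<open>K = n - 3\<close> the remaining factorial is
      \<open>fact 2\<close>, which saves one power of two.\<close>
    have g: "prod ?g {1..K} \<le> 2 ^ (n - 2) * fact (n - 1)"
    proof -
      have 2: "n - 1 - K = 2" and "n - 1 = Suc (n - 2)"
        using K(1) by auto
      then have "(2::real) ^ (n - 1) = 2 * 2 ^ (n - 2)"
        by (simp only: power_Suc)
      moreover have "prod ?g {1..K} * 2 \<le> fact (n - 1) * 2 ^ (n - 1)"
        using growth[of K] K(1) unfolding 2 fact_2 by simp
      ultimately show ?thesis by (simp add: mult.commute)
    qed
    have "(\<Prod>i\<in>{1..Suc K}. real (x i)) \<le> prod ?g {1..K} * prod vseq {1..Suc K}"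
      using pos mono one K by (intro prod_prefix_bound) auto
    also have "\<dots> \<le> 2 ^ (n - 2) * fact (n - 1) * prod vseq {1..Suc K}"
      using g prod_vseq_ge_1[of "Suc K"] by (intro mult_right_mono) auto
    finally show ?thesis
      using K(1) by simp
  qed
  show ?thesis
    using lower upper1 upper2 by simp
qed

end
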